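(* Let $(W,S)$ be a Coxeter system and let $u,v\in W$ be such that $u\leq_R v$. If $E\subseteq \mathcal{P}(S)$ is a family of subsets of $S$ such that $\bigcap_{J\in E}J=S\setminus D_R(u^{-1}v)$, then $$T_L(v)=T_L(u)\,\cup\,\bigcup_{J\in E}T_L(v^J).$$
   Context: $(W,S)$ is a Coxeter system: $W$ is the group with generating set $S$ (not assumed finite) and relations $(st)^{m(s,t)}=e$ for $s,t\in S$, where $m:S\times S\to\{1,2,\ldots,\infty\}$ is a symmetric Coxeter matrix with $m(s,t)=1$ if and only if $s=t$ (the value $\infty$ means no relation is imposed). The length function is $\ell:W\to\mathbb{N}$, where $\ell(w)$ is the minimal length of a word in $S$ representing $w$. The set of reflections is $T:=\{wsw^{-1}: w\in W,\ s\in S\}$. For $w\in W$, $T_L(w):=\{t\in T:\ell(tw)<\ell(w)\}$ and $D_R(w):=\{s\in S:\ell(ws)<\ell(w)\}$. The right weak order $\leq_R$ on $W$ is the partial order whose covering relations are: $v$ covers $u$ if and only if $\ell(u)<\ell(v)$ and $u^{-1}v\in S$. For $J\subseteq S$, $W_J$ is the subgroup of $W$ generated by $J$, and $w^J$ denotes the unique element of minimal length in the coset $wW_J$. $\mathcal{P}(S)$ is the power set of $S$; intersections of families of subsets of $S$ are taken inside $S$, so the intersection of the empty family is $S$. *)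

theory Defs
  imports "HOL-Algebra.Algebra" "HOL-Library.Extended_Nat"
begin

text \<open>
  Words in the free group on a set are lists of signed letters: the pair \<open>(s, True)\<close> stands
  for \<open>s\<close> and \<open>(s, False)\<close> for its formal inverse. The congruence below is generated by
  free cancellation and deletion of relators, so the words over \<open>S\<close> modulo it form the
  group presented by \<open>S\<close> and \<open>R\<close>.
\<close>

type_synonym 'a signed_word = "('a \<times> bool) list"

inductive presentation_eq ::
    "'a set \<Rightarrow> 'a signed_word set \<Rightarrow> 'a signed_word \<Rightarrow> 'a signed_word \<Rightarrow> bool"
  for S :: "'a set" and R :: "'a signed_word set" where
  refl: "presentation_eq S R xs xs"
| sym: "presentation_eq S R xs ys \<Longrightarrow> presentation_eq S R ys xs"
| trans: "presentation_eq S R xs ys \<Longrightarrow> presentation_eq S R ys zs \<Longrightarrow> presentation_eq S R xs zs"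
| cancel: "s \<in> S \<Longrightarrow> presentation_eq S R (xs @ [(s, b), (s, \<not> b)] @ ys) (xs @ ys)"
| relator: "r \<in> R \<Longrightarrow> presentation_eq S R (xs @ r @ ys) (xs @ ys)"

definition signed_word_value :: "('a, 'b) monoid_scheme \<Rightarrow> 'a signed_word \<Rightarrow> 'a" where
  "signed_word_value G w =
     foldr (\<lambda>(s, b) x. (if b then s else inv\<^bsub>G\<^esub> s) \<otimes>\<^bsub>G\<^esub> x) w \<one>\<^bsub>G\<^esub>"

text \<open>
  The canonical map from the group presented by \<open>S\<close> and \<open>R\<close> to \<open>G\<close> is well defined and
  bijective: it is onto because \<open>S\<close> generates \<open>G\<close>, and the equivalence says both that the
  relators hold in \<open>G\<close> and that every relation of \<open>G\<close> among elements of \<open>S\<close> follows from them.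
\<close>

definition has_presentation ::
    "('a, 'b) monoid_scheme \<Rightarrow> 'a set \<Rightarrow> 'a signed_word set \<Rightarrow> bool" where
  "has_presentation G S R \<longleftrightarrow>
     group G \<and> S \<subseteq> carrier G \<and> generate G S = carrier G \<and>
     (\<forall>w. set w \<subseteq> S \<times> UNIV \<longrightarrow>
        (signed_word_value G w = \<one>\<^bsub>G\<^esub> \<longleftrightarrow> presentation_eq S R w []))"

definition coxeter_matrix :: "'a set \<Rightarrow> ('a \<Rightarrow> 'a \<Rightarrow> enat) \<Rightarrow> bool" where
  "coxeter_matrix S m \<longleftrightarrow>
     (\<forall>s\<in>S. \<forall>t\<in>S. 1 \<le> m s t \<and> m s t = m t s \<and> (m s t = 1 \<longleftrightarrow> s = t))"

text \<open>Pairs with \<open>m s t = \<infinity>\<close> contribute no relator.\<close>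

definition coxeter_relators :: "'a set \<Rightarrow> ('a \<Rightarrow> 'a \<Rightarrow> enat) \<Rightarrow> 'a signed_word set" where
  "coxeter_relators S m =
     {concat (replicate k [(s, True), (t, True)]) | s t k. s \<in> S \<and> t \<in> S \<and> m s t = enat k}"

definition coxeter_system ::
    "('a, 'b) monoid_scheme \<Rightarrow> 'a set \<Rightarrow> ('a \<Rightarrow> 'a \<Rightarrow> enat) \<Rightarrow> bool" where
  "coxeter_system W S m \<longleftrightarrow>
     coxeter_matrix S m \<and> has_presentation W S (coxeter_relators S m)"

definition cox_length :: "('a, 'b) monoid_scheme \<Rightarrow> 'a set \<Rightarrow> 'a \<Rightarrow> nat" where
  "cox_length W S w =
     (LEAST n. \<exists>ws. set ws \<subseteq> S \<and> length ws = n \<and> foldr (\<otimes>\<^bsub>W\<^esub>) ws \<one>\<^bsub>W\<^esub> = w)"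

definition reflections :: "('a, 'b) monoid_scheme \<Rightarrow> 'a set \<Rightarrow> 'a set" where
  "reflections W S = {w \<otimes>\<^bsub>W\<^esub> s \<otimes>\<^bsub>W\<^esub> inv\<^bsub>W\<^esub> w | w s. w \<in> carrier W \<and> s \<in> S}"

definition left_inversions :: "('a, 'b) monoid_scheme \<Rightarrow> 'a set \<Rightarrow> 'a \<Rightarrow> 'a set" where
  "left_inversions W S w =
     {t \<in> reflections W S. cox_length W S (t \<otimes>\<^bsub>W\<^esub> w) < cox_length W S w}"

definition right_descents :: "('a, 'b) monoid_scheme \<Rightarrow> 'a set \<Rightarrow> 'a \<Rightarrow> 'a set" where
  "right_descents W S w = {s \<in> S. cox_length W S (w \<otimes>\<^bsub>W\<^esub> s) < cox_length W S w}"

definition right_weak_cover :: "('a, 'b) monoid_scheme \<Rightarrow> 'a set \<Rightarrow> 'a \<Rightarrow> 'a \<Rightarrow> bool" where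
  "right_weak_cover W S u v \<longleftrightarrow>
     u \<in> carrier W \<and> v \<in> carrier W \<and>
     cox_length W S u < cox_length W S v \<and> inv\<^bsub>W\<^esub> u \<otimes>\<^bsub>W\<^esub> v \<in> S"

definition right_weak_le :: "('a, 'b) monoid_scheme \<Rightarrow> 'a set \<Rightarrow> 'a \<Rightarrow> 'a \<Rightarrow> bool" where
  "right_weak_le W S u v \<longleftrightarrow>
     u \<in> carrier W \<and> v \<in> carrier W \<and> (right_weak_cover W S)\<^sup>*\<^sup>* u v"

definition min_coset_rep :: "('a, 'b) monoid_scheme \<Rightarrow> 'a set \<Rightarrow> 'a set \<Rightarrow> 'a \<Rightarrow> 'a" where
  "min_coset_rep W S J w =
     (THE x. x \<in> w <#\<^bsub>W\<^esub> generate W J \<and>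
        (\<forall>y \<in> w <#\<^bsub>W\<^esub> generate W J. cox_length W S x \<le> cox_length W S y))"

end

theory Submission
  imports Defs
begin

text \<open>
  A word \<open>s\<^sub>1 \<dots> s\<^sub>n\<close> determines the reflections \<open>t\<^sub>i = s\<^sub>1 \<dots> s\<^sub>i \<dots> s\<^sub>1\<close>. Multiplying the word on
  the left by \<open>t\<^sub>i\<close> deletes its \<open>i\<close>-th letter. In the reflection list of a Coxeter relator
  \<open>(st)\<^sup>k\<close> the first half is repeated by the second half, so the parity with which a reflection
  occurs depends only on the element represented by the word (\<open>odd_reflections_cong\<close>). The reflections with odd
  multiplicity are exactly the left inversions \<open>T\<^sub>L(w)\<close> (\<open>left_inversions_word_prod\<close>), which gives the cocycle rule
  \<open>T\<^sub>L(xy) = T\<^sub>L(x) \<triangle> x T\<^sub>L(y) x\<^sup>-\<^sup>1\<close> (\<open>left_inversions_mult\<close>) and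
  \<open>\<ell>(w) = |T\<^sub>L(w)|\<close>; these carry the whole proof.

  If \<open>x\<close> is shortest in \<open>x W\<^sub>J\<close> and \<open>y \<in> W\<^sub>J\<close>, the symmetric difference is a disjoint union
  (\<open>shortest_left_inversions\<close>): a
  common element would be \<open>t = x r x\<^sup>-\<^sup>1\<close> with \<open>r \<in> W\<^sub>J\<close>, and then \<open>tx = xr\<close> would be a shorter
  element of the coset. So \<open>T\<^sub>L(v\<^sup>J) \<subseteq> T\<^sub>L(v)\<close>, and similarly \<open>T\<^sub>L(u) \<subseteq> T\<^sub>L(v)\<close> along each covering
  step of the weak order. This is one inclusion.

  For the other, put \<open>w = u\<^sup>-\<^sup>1 v\<close> and let \<open>t \<in> T\<^sub>L(v)\<close> lie neither in \<open>T\<^sub>L(u)\<close> nor in any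
  \<open>T\<^sub>L(v\<^sup>J)\<close>. The cocycle rule for \<open>v = v\<^sup>J y\<close> puts \<open>r = v\<^sup>-\<^sup>1 t v\<close> into every \<open>W\<^sub>J\<close>, hence into \<open>W\<^sub>K\<close>
  (\<open>generate_Inter\<close>), where \<open>K = S - D\<^sub>R(w)\<close> is the intersection of the family. The cocycle rule for \<open>v = u w\<close>
  makes \<open>u\<^sup>-\<^sup>1 t u\<close> an inversion of \<open>w\<close>, and \<open>u\<^sup>-\<^sup>1 t u w = w r\<close>, so \<open>\<ell>(wr) < \<ell>(w)\<close>.
  But \<open>w\<close> has no right descent in \<open>K\<close>, so it is shortest in \<open>w W\<^sub>K\<close> (\<open>shortest_if_no_descent\<close>), a
  contradiction.
\<close>

section \<open>Words and their reflections\<close>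

locale coxeter_group = group W for W :: "('a, 'b) monoid_scheme" (structure) +
  fixes S :: "'a set" and m :: "'a \<Rightarrow> 'a \<Rightarrow> enat"
  assumes coxeter_sys: "coxeter_system W S m"
begin

abbreviation word_prod :: "'a list \<Rightarrow> 'a" where
  "word_prod ws \<equiv> foldr (\<otimes>) ws \<one>"

abbreviation len :: "'a \<Rightarrow> nat" where
  "len \<equiv> cox_length W S"

abbreviation left_inv :: "'a \<Rightarrow> 'a set" where
  "left_inv \<equiv> left_inversions W S"

definition conj_by :: "'a \<Rightarrow> 'a \<Rightarrow> 'a" where
  "conj_by x t = x \<otimes> t \<otimes> inv x"

text \<open>
  The reflections \<open>s\<^sub>1 \<dots> s\<^sub>i \<dots> s\<^sub>1\<close> of \<open>s\<^sub>1 \<dots> s\<^sub>n\<close>, in the order of \<open>i\<close>: prepending a letter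
  conjugates all later ones.
\<close>

primrec word_reflections :: "'a list \<Rightarrow> 'a list" where
  "word_reflections [] = []"
| "word_reflections (s # ws) = s # map (conj_by s) (word_reflections ws)"

definition odd_reflections :: "'a list \<Rightarrow> 'a set" where
  "odd_reflections ws = {t. odd (count_list (word_reflections ws) t)}"

lemma generators_closed: "S \<subseteq> carrier W"
  using coxeter_sys by (simp add: coxeter_system_def has_presentation_def)

lemma generator_closed [simp]: "s \<in> S \<Longrightarrow> s \<in> carrier W"
  using generators_closed by blast

lemma generate_S: "generate W S = carrier W"
  using coxeter_sys by (simp add: coxeter_system_def has_presentation_def)

lemma trivial_iff_presentation_eq:
  "set w \<subseteq> S \<times> UNIV \<Longrightarrow>
    signed_word_value W w = \<one> \<longleftrightarrow> presentation_eq S (coxeter_relators S m) w []"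
  using coxeter_sys by (simp add: coxeter_system_def has_presentation_def)

lemma signed_word_value_positive:
  "signed_word_value W (map (\<lambda>s. (s, True)) ws) = word_prod ws"
  by (induction ws) (simp_all add: signed_word_value_def)

lemma relator_prod:
  assumes "s \<in> S" "t \<in> S" "m s t = enat k"
  shows "word_prod (concat (replicate k [s, t])) = \<one>"
proof -
  let ?r = "concat (replicate k [(s, True), (t, True)])"
  have "?r \<in> coxeter_relators S m"
    using assms by (auto simp: coxeter_relators_def)
  then have "presentation_eq S (coxeter_relators S m) ?r []"
    using presentation_eq.relator[of ?r "coxeter_relators S m" S "[]" "[]"] by simp
  moreover have "set ?r \<subseteq> S \<times> UNIV"
    using assms by auto
  ultimately have "signed_word_value W ?r = \<one>"
    using trivial_iff_presentation_eq by blast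
  moreover have "?r = map (\<lambda>s. (s, True)) (concat (replicate k [s, t]))"
    by (simp add: map_concat)
  ultimately show ?thesis
    using signed_word_value_positive by metis
qed

lemma generator_square [simp]:
  assumes "s \<in> S"
  shows "s \<otimes> s = \<one>"
proof -
  have "m s s = enat 1"
    using coxeter_sys assms by (simp add: coxeter_system_def coxeter_matrix_def one_enat_def)
  from relator_prod[OF assms assms this] show ?thesis
    using assms by simp
qed

lemma generator_inv [simp]: "s \<in> S \<Longrightarrow> inv s = s"
  by (simp add: inv_equality)

lemma word_prod_closed [simp]: "set ws \<subseteq> S \<Longrightarrow> word_prod ws \<in> carrier W"
  by (induction ws) auto

lemma word_prod_append:
  "set xs \<subseteq> S \<Longrightarrow> set ys \<subseteq> S \<Longrightarrow> word_prod (xs @ ys) = word_prod xs \<otimes> word_prod ys"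
  by (induction xs) (auto simp: m_assoc)

lemma word_prod_rev: "set ws \<subseteq> S \<Longrightarrow> word_prod (rev ws) = inv (word_prod ws)"
proof (induction ws)
  case (Cons s ws)
  then have "word_prod (rev (s # ws)) = word_prod (rev ws) \<otimes> word_prod [s]"
    using word_prod_append[of "rev ws" "[s]"] by simp
  with Cons show ?case
    by (simp add: inv_mult_group)
qed simp

lemma conj_by_closed [simp]:
  "x \<in> carrier W \<Longrightarrow> t \<in> carrier W \<Longrightarrow> conj_by x t \<in> carrier W"
  by (simp add: conj_by_def)

lemma conj_by_mult:
  "x \<in> carrier W \<Longrightarrow> y \<in> carrier W \<Longrightarrow> t \<in> carrier W \<Longrightarrow>
    conj_by x (conj_by y t) = conj_by (x \<otimes> y) t"
  by (simp add: conj_by_def inv_mult_group m_assoc)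

lemma conj_by_one [simp]: "t \<in> carrier W \<Longrightarrow> conj_by \<one> t = t"
  by (simp add: conj_by_def)

lemma conj_by_inv [simp]:
  "x \<in> carrier W \<Longrightarrow> t \<in> carrier W \<Longrightarrow> conj_by (inv x) (conj_by x t) = t"
  "x \<in> carrier W \<Longrightarrow> t \<in> carrier W \<Longrightarrow> conj_by x (conj_by (inv x) t) = t"
  by (simp_all add: conj_by_mult)

lemma conj_by_mult_right:
  "x \<in> carrier W \<Longrightarrow> t \<in> carrier W \<Longrightarrow> conj_by x t \<otimes> x = x \<otimes> t"
  by (simp add: conj_by_def m_assoc)

lemma conj_by_generator_self [simp]: "s \<in> S \<Longrightarrow> conj_by s s = s"
  by (simp add: conj_by_def)

lemma inj_on_conj_by: "x \<in> carrier W \<Longrightarrow> inj_on (conj_by x) (carrier W)"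
  by (metis conj_by_inv(1) inj_onI)

lemma word_reflections_closed:
  "set ws \<subseteq> S \<Longrightarrow> set (word_reflections ws) \<subseteq> carrier W"
  by (induction ws) auto

lemma word_reflections_append:
  assumes "set xs \<subseteq> S" "set ys \<subseteq> S"
  shows "word_reflections (xs @ ys) =
    word_reflections xs @ map (conj_by (word_prod xs)) (word_reflections ys)"
  using assms
proof (induction xs)
  case Nil
  then show ?case
    using word_reflections_closed[of ys] by (auto intro!: map_idI[symmetric])
next
  case (Cons s xs)
  then have "conj_by s (conj_by (word_prod xs) t) = conj_by (s \<otimes> word_prod xs) t"
    if "t \<in> set (word_reflections ys)" for t
    using that word_reflections_closed[of ys] by (auto intro!: conj_by_mult)
  with Cons show ?case by simp
qed

lemma count_list_map_conj_by:
  assumes "x \<in> carrier W" "t \<in> carrier W" "set ts \<subseteq> carrier W"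
  shows "count_list (map (conj_by x) ts) t = count_list ts (conj_by (inv x) t)"
proof -
  have "conj_by x r = t \<longleftrightarrow> r = conj_by (inv x) t" if "r \<in> carrier W" for r
    using that assms by auto
  with assms(3) show ?thesis
    by (induction ts) auto
qed

lemma odd_reflections_closed: "set ws \<subseteq> S \<Longrightarrow> odd_reflections ws \<subseteq> carrier W"
  using word_reflections_closed count_notin unfolding odd_reflections_def
  by (smt (verit, best) even_zero mem_Collect_eq subset_iff)

lemma odd_reflections_subset: "odd_reflections ws \<subseteq> set (word_reflections ws)"
  unfolding odd_reflections_def by (auto intro: ccontr simp: count_notin)

lemma odd_reflections_distinct:
  assumes "distinct (word_reflections ws)"
  shows "odd_reflections ws = set (word_reflections ws)"
proof -
  have "distinct ts \<Longrightarrow> count_list ts t = (if t \<in> set ts then 1 else 0)" for ts :: "'a list" and t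
    by (induction ts) auto
  with assms show ?thesis
    by (simp add: odd_reflections_def)
qed

lemma odd_reflections_append:
  assumes "set xs \<subseteq> S" "set ys \<subseteq> S" "t \<in> carrier W"
  shows "t \<in> odd_reflections (xs @ ys) \<longleftrightarrow>
    (t \<in> odd_reflections xs) \<noteq> (conj_by (inv (word_prod xs)) t \<in> odd_reflections ys)"
  using assms word_reflections_closed[of ys]
  by (auto simp: odd_reflections_def word_reflections_append count_list_map_conj_by)

lemma word_reflection_in_reflections:
  assumes "set ws \<subseteq> S" "t \<in> set (word_reflections ws)"
  shows "t \<in> reflections W S"
  using assms
proof (induction ws arbitrary: t)
  case (Cons s ws)
  show ?case
  proof (cases "t = s")
    case True
    have "s = \<one> \<otimes> s \<otimes> inv \<one>" using Cons.prems by simp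
    then show ?thesis
      unfolding reflections_def using True Cons.prems by fastforce
  next
    case False
    then obtain r where r: "r \<in> set (word_reflections ws)" "t = conj_by s r"
      using Cons.prems by auto
    then obtain w q where wq: "w \<in> carrier W" "q \<in> S" "r = conj_by w q"
      using Cons.IH[of r] Cons.prems(1) unfolding reflections_def conj_by_def by auto
    have "t = conj_by (s \<otimes> w) q"
      using wq r Cons.prems by (simp add: conj_by_mult)
    moreover have "s \<otimes> w \<in> carrier W"
      using wq Cons.prems by simp
    ultimately show ?thesis
      unfolding reflections_def conj_by_def using wq by blast
  qed
qed simp

text \<open>Left multiplication by the \<open>i\<close>-th reflection of a word cancels its \<open>i\<close>-th letter.\<close>

lemma exchange:
  assumes "set ws \<subseteq> S" "t \<in> set (word_reflections ws)"
  shows "\<exists>us. length us < length ws \<and> set us \<subseteq> set ws \<and> word_prod us = t \<otimes> word_prod ws"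
  using assms
proof (induction ws arbitrary: t)
  case (Cons s ws)
  show ?case
  proof (cases "t = s")
    case True
    have "s \<otimes> (s \<otimes> word_prod ws) = word_prod ws"
      using Cons.prems by (simp add: m_assoc[symmetric])
    with True show ?thesis by (intro exI[of _ ws]) auto
  next
    case False
    then obtain r where r: "r \<in> set (word_reflections ws)" "t = conj_by s r"
      using Cons.prems by auto
    then obtain us where us: "length us < length ws" "set us \<subseteq> set ws"
      "word_prod us = r \<otimes> word_prod ws"
      using Cons.IH[of r] Cons.prems(1) by auto
    have rc: "r \<in> carrier W"
      using r Cons.prems word_reflections_closed[of ws] by auto
    have "t \<otimes> (s \<otimes> word_prod ws) = (conj_by s r \<otimes> s) \<otimes> word_prod ws"
      using rc r Cons.prems by (simp add: m_assoc)
    also have "\<dots> = word_prod (s # us)"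
      using rc us Cons.prems by (simp add: conj_by_mult_right m_assoc)
    finally show ?thesis
      using us by (intro exI[of _ "s # us"]) auto
  qed
qed simp

text \<open>
  If two reflections of a word coincide, their product is trivial, so both of the
  corresponding letters can be deleted.
\<close>

lemma deletion:
  assumes "set ws \<subseteq> S" "\<not> distinct (word_reflections ws)"
  shows "\<exists>us. length us < length ws \<and> set us \<subseteq> set ws \<and> word_prod us = word_prod ws"
  using assms
proof (induction ws)
  case (Cons s ws)
  have closed: "set (word_reflections ws) \<subseteq> carrier W"
    using Cons.prems word_reflections_closed by auto
  have "inj_on (conj_by s) (set (word_reflections ws))"
    using closed Cons.prems inj_on_conj_by[of s] inj_on_subset by auto
  then consider "s \<in> conj_by s ` set (word_reflections ws)" | "\<not> distinct (word_reflections ws)"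
    using Cons.prems by (auto simp: distinct_map)
  then show ?case
  proof cases
    case 1
    then obtain r where r: "r \<in> set (word_reflections ws)" "conj_by s r = s"
      by auto
    then have "r = s"
      using closed Cons.prems
      by (metis conj_by_generator_self conj_by_inv(1) generator_closed generator_inv
          list.set_intros(1) subsetD)
    with r obtain us where "length us < length ws" "set us \<subseteq> set ws"
      "word_prod us = s \<otimes> word_prod ws"
      using exchange[of ws s] Cons.prems by auto
    then show ?thesis by (intro exI[of _ us]) auto
  next
    case 2
    then obtain us where "length us < length ws" "set us \<subseteq> set ws" "word_prod us = word_prod ws"
      using Cons by auto
    then show ?thesis by (intro exI[of _ "s # us"]) auto
  qed
qed simp

section \<open>Invariance of the odd reflections\<close>

text \<open>
  Conjugating by the prefix turns the reflection list \<open>ts @ ts\<close> of the inserted word into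
  another doubled list, and a trivial product leaves the reflections of the suffix unchanged.
\<close>

lemma odd_reflections_insert:
  assumes "set xs \<subseteq> S" "set r \<subseteq> S" "set ys \<subseteq> S"
    and "word_prod r = \<one>" "word_reflections r = ts @ ts"
  shows "odd_reflections (xs @ r @ ys) = odd_reflections (xs @ ys)"
proof -
  have "map (conj_by \<one>) (word_reflections ys) = word_reflections ys"
    using word_reflections_append[of "[]" ys] assms by simp
  then have "word_reflections (r @ ys) = ts @ ts @ word_reflections ys"
    using word_reflections_append[of r ys] assms by simp
  then show ?thesis
    using assms by (auto simp: odd_reflections_def word_reflections_append)
qed

lemma word_reflections_dihedral:
  assumes "s \<in> S" "t \<in> S"
  shows "word_reflections (concat (replicate k [s, t])) =
    map (\<lambda>i. (s \<otimes> t) [^] i \<otimes> s) [0..<2 * k]"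
proof (induction k)
  case (Suc k)
  have step: "conj_by s (conj_by t ((s \<otimes> t) [^] i \<otimes> s)) = (s \<otimes> t) [^] Suc (Suc i) \<otimes> s" for i :: nat
  proof -
    have "(s \<otimes> t) [^] Suc (Suc i) \<otimes> s = (s \<otimes> t) \<otimes> (s \<otimes> t) [^] i \<otimes> (s \<otimes> t) \<otimes> s"
      using assms nat_pow_Suc2[of "s \<otimes> t" i] nat_pow_Suc[of "s \<otimes> t" "Suc i"] by simp
    then show ?thesis
      using assms by (simp add: conj_by_def m_assoc)
  qed
  have "[0..<2 * Suc k] = 0 # 1 # map (\<lambda>i. Suc (Suc i)) [0..<2 * k]"
    by (simp add: upt_rec[of 0] upt_rec[of 1] map_Suc_upt[symmetric] o_def del: upt_Suc)
  then have "map (\<lambda>i. (s \<otimes> t) [^] i \<otimes> s) [0..<2 * Suc k] =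
    s # conj_by s t # map (\<lambda>i. (s \<otimes> t) [^] Suc (Suc i) \<otimes> s) [0..<2 * k]"
    using assms by (simp add: conj_by_def o_def del: upt_Suc mult_Suc_right)
  also have "\<dots> = word_reflections (concat (replicate (Suc k) [s, t]))"
    by (simp only: replicate_Suc concat.simps append.simps word_reflections.simps Suc.IH list.map
        map_map o_def step)
  finally show ?case ..
qed simp

text \<open>
  Since \<open>(st)\<^sup>k = \<one>\<close>, the sequence \<open>(st)\<^sup>i s\<close> of length \<open>2k\<close> has period \<open>k\<close>.
\<close>

lemma word_reflections_relator:
  assumes "s \<in> S" "t \<in> S" "m s t = enat k"
  shows "\<exists>ts. word_reflections (concat (replicate k [s, t])) = ts @ ts"
proof -
  have "word_prod (concat (replicate j [s, t])) = (s \<otimes> t) [^] j" for j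
    using assms nat_pow_Suc2[of "s \<otimes> t"] by (induction j) (simp_all add: m_assoc)
  with relator_prod[OF assms] have one: "(s \<otimes> t) [^] k = \<one>"
    by simp
  have "(s \<otimes> t) [^] (i + k) = (s \<otimes> t) [^] i" for i
    using assms one nat_pow_mult[of "s \<otimes> t" i k] by simp
  moreover have "[0..<2 * k] = [0..<k] @ map (\<lambda>i. i + k) [0..<k]"
    by (metis add_0 le_add2 map_add_upt mult_2 upt_add_eq_append zero_le)
  ultimately show ?thesis
    using word_reflections_dihedral[OF assms(1,2), of k] by (auto simp: o_def)
qed

text \<open>
  The equivalence generated by the relators ranges over words with arbitrary letters, even if
  its endpoints are words over \<open>S\<close>. Reading letters outside \<open>S\<close> as trivial keeps every
  intermediate word meaningful.
\<close>

lemma odd_reflections_presentation_eq: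
  defines "f \<equiv> \<lambda>w :: 'a signed_word. filter (\<lambda>s. s \<in> S) (map fst w)"
  assumes "presentation_eq S (coxeter_relators S m) xs ys"
  shows "odd_reflections (f xs) = odd_reflections (f ys)"
  using assms(2)
proof induction
  case (cancel s xs b ys)
  have "odd_reflections (f xs @ [s, s] @ f ys) = odd_reflections (f xs @ f ys)"
    using cancel by (intro odd_reflections_insert[of _ _ _ "[s]"]) (auto simp: f_def)
  with cancel show ?case by (simp add: f_def)
next
  case (relator r xs ys)
  then obtain s t k where r: "r = concat (replicate k [(s, True), (t, True)])"
    and st: "s \<in> S" "t \<in> S" "m s t = enat k"
    by (auto simp: coxeter_relators_def)
  have fr: "f r = concat (replicate k [s, t])"
    unfolding r using st(1,2) by (induct k) (simp_all add: f_def)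
  obtain ts where "word_reflections (f r) = ts @ ts"
    using word_reflections_relator[OF st] fr by auto
  then have "odd_reflections (f xs @ f r @ f ys) = odd_reflections (f xs @ f ys)"
    using relator_prod[OF st] fr st(1,2) by (intro odd_reflections_insert) (auto simp: f_def)
  then show ?case by (simp add: f_def)
qed simp_all

text \<open>
  Since every relation of \<open>W\<close> follows from the Coxeter relators, a word with trivial product is
  joined to the empty word by steps that preserve the odd reflections.
\<close>

lemma odd_reflections_trivial:
  assumes "set ws \<subseteq> S" "word_prod ws = \<one>"
  shows "odd_reflections ws = {}"
proof -
  let ?w = "map (\<lambda>s. (s, True)) ws"
  have "presentation_eq S (coxeter_relators S m) ?w []"
    using assms trivial_iff_presentation_eq[of ?w] signed_word_value_positive[of ws] by auto
  then have "odd_reflections (filter (\<lambda>s. s \<in> S) (map fst ?w)) = odd_reflections []"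
    using odd_reflections_presentation_eq by fastforce
  moreover have "filter (\<lambda>s. s \<in> S) (map fst ?w) = ws"
    using assms by (auto simp: o_def filter_id_conv)
  ultimately show ?thesis
    by (simp add: odd_reflections_def)
qed

lemma odd_reflections_rev:
  assumes "set ws \<subseteq> S" "t \<in> carrier W"
  shows "t \<in> odd_reflections ws \<longleftrightarrow> conj_by (inv (word_prod ws)) t \<in> odd_reflections (rev ws)"
proof -
  have "word_prod (ws @ rev ws) = \<one>"
    using assms word_prod_append[of ws "rev ws"] by (simp add: word_prod_rev)
  then have "odd_reflections (ws @ rev ws) = {}"
    using assms odd_reflections_trivial[of "ws @ rev ws"] by auto
  then show ?thesis
    using odd_reflections_append[of ws "rev ws" t] assms by auto
qed

lemma odd_reflections_cong:
  assumes "set xs \<subseteq> S" "set ys \<subseteq> S" "word_prod xs = word_prod ys"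
  shows "odd_reflections xs = odd_reflections ys"
proof -
  have "word_prod (xs @ rev ys) = \<one>"
    using assms word_prod_append[of xs "rev ys"] by (simp add: word_prod_rev)
  then have "odd_reflections (xs @ rev ys) = {}"
    using assms odd_reflections_trivial[of "xs @ rev ys"] by auto
  then have "t \<in> odd_reflections xs \<longleftrightarrow> t \<in> odd_reflections ys" if "t \<in> carrier W" for t
    using odd_reflections_append[of xs "rev ys" t] odd_reflections_rev[of ys t] assms that by auto
  then show ?thesis
    using odd_reflections_closed assms by blast
qed

section \<open>Left inversions and length\<close>

lemma generate_eq_words:
  assumes "J \<subseteq> S"
  shows "generate W J = word_prod ` {ws. set ws \<subseteq> J}"
proof
  show "generate W J \<subseteq> word_prod ` {ws. set ws \<subseteq> J}"
  proof
    fix w assume "w \<in> generate W J"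
    then show "w \<in> word_prod ` {ws. set ws \<subseteq> J}"
    proof induction
      case one
      show ?case by (rule image_eqI[of _ _ "[]"]) auto
    next
      case (incl s)
      then show ?case using assms by (intro image_eqI[of _ _ "[s]"]) auto
    next
      case (inv s)
      then have "s \<in> S" using assms by auto
      with inv show ?case by (intro image_eqI[of _ _ "[s]"]) auto
    next
      case (eng x y)
      then obtain xs ys where xys: "set xs \<subseteq> J" "x = word_prod xs" "set ys \<subseteq> J" "y = word_prod ys"
        by auto
      with assms have "x \<otimes> y = word_prod (xs @ ys)"
        by (subst word_prod_append) auto
      with xys show ?case by (intro image_eqI[of _ _ "xs @ ys"]) auto
    qed
  qed
  have "word_prod ws \<in> generate W J" if "set ws \<subseteq> J" for ws
    using that by (induction ws) (auto intro: generate.intros)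
  then show "word_prod ` {ws. set ws \<subseteq> J} \<subseteq> generate W J"
    by auto
qed

lemma word_prod_in_generate: "J \<subseteq> S \<Longrightarrow> set ws \<subseteq> J \<Longrightarrow> word_prod ws \<in> generate W J"
  by (auto simp: generate_eq_words)

lemma subgroup_generate: "J \<subseteq> S \<Longrightarrow> subgroup (generate W J) W"
  by (rule generate_is_subgroup) (use generators_closed in blast)

lemma generate_closed: "J \<subseteq> S \<Longrightarrow> x \<in> generate W J \<Longrightarrow> x \<in> carrier W"
  by (rule subgroup.mem_carrier[OF subgroup_generate])

lemma word_exists:
  assumes "w \<in> carrier W"
  obtains ws where "set ws \<subseteq> S" "word_prod ws = w"
proof -
  have "w \<in> word_prod ` {ws. set ws \<subseteq> S}"
    using assms generate_S generate_eq_words[of S] by simp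
  then show ?thesis using that by blast
qed

lemma len_le_word: "set ws \<subseteq> S \<Longrightarrow> len (word_prod ws) \<le> length ws"
  unfolding cox_length_def by (rule Least_le) blast

lemma reduced_word_exists:
  assumes "w \<in> carrier W"
  obtains ws where "set ws \<subseteq> S" "word_prod ws = w" "length ws = len w"
proof -
  obtain us where "set us \<subseteq> S" "word_prod us = w"
    using assms word_exists by blast
  then have "\<exists>n ws. set ws \<subseteq> S \<and> length ws = n \<and> word_prod ws = w"
    by blast
  from LeastI_ex[OF this] show ?thesis
    using that unfolding cox_length_def by blast
qed

lemma odd_reflection_shortens:
  assumes "set ws \<subseteq> S" "t \<in> odd_reflections ws"
  shows "t \<in> reflections W S" "len (t \<otimes> word_prod ws) < len (word_prod ws)"
proof -
  obtain vs where vs: "set vs \<subseteq> S" "word_prod vs = word_prod ws" "length vs = len (word_prod ws)"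
    using reduced_word_exists assms by (metis word_prod_closed)
  have "t \<in> odd_reflections vs"
    using assms odd_reflections_cong[OF assms(1) vs(1)] vs by simp
  then have t: "t \<in> set (word_reflections vs)"
    using odd_reflections_subset by auto
  with vs show "t \<in> reflections W S"
    using word_reflection_in_reflections by blast
  obtain us where us: "length us < length vs" "set us \<subseteq> set vs" "word_prod us = t \<otimes> word_prod vs"
    using exchange[OF vs(1) t] by blast
  then have "len (t \<otimes> word_prod vs) \<le> length us"
    using len_le_word[of us] vs by auto
  with us vs show "len (t \<otimes> word_prod ws) < len (word_prod ws)"
    by simp
qed

text \<open>
  In the palindrome \<open>a s a\<^sup>-\<^sup>1\<close> representing \<open>t\<close>, the contributions of \<open>a\<close> and of \<open>a\<^sup>-\<^sup>1\<close> to the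
  multiplicity of \<open>t\<close> have equal parity, and the middle letter contributes once.
\<close>

lemma reflection_word:
  assumes "t \<in> reflections W S"
  obtains ws where "set ws \<subseteq> S" "word_prod ws = t" "t \<in> odd_reflections ws" "t \<otimes> t = \<one>"
proof -
  obtain a s where a: "a \<in> carrier W" and s: "s \<in> S" and t: "t = conj_by a s"
    using assms by (auto simp: reflections_def conj_by_def)
  obtain as where as: "set as \<subseteq> S" "word_prod as = a"
    using word_exists a by blast
  have tc: "t \<in> carrier W" "conj_by (inv a) t = s"
    using t a s by auto
  have sc: "conj_by (inv (word_prod [s])) s = s"
    using s by simp
  have odd_s: "s \<in> odd_reflections [s]"
    by (simp add: odd_reflections_def)
  have "word_prod (as @ [s] @ rev as) = t"
    using as s a word_prod_append[of as "[s] @ rev as"] word_prod_append[of "[s]" "rev as"]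
    by (simp add: t conj_by_def word_prod_rev m_assoc)
  moreover have "t \<in> odd_reflections (as @ [s] @ rev as)"
    using odd_reflections_append[of as "[s] @ rev as" t] odd_reflections_rev[of as t]
      odd_reflections_append[of "[s]" "rev as" s] as s tc sc odd_s by auto
  moreover have "t \<otimes> t = \<one>"
  proof -
    have "t \<otimes> t = t \<otimes> (a \<otimes> s \<otimes> inv a)"
      by (simp add: t conj_by_def)
    also have "\<dots> = (t \<otimes> a) \<otimes> s \<otimes> inv a"
      using a s tc(1) by (simp add: m_assoc)
    also have "t \<otimes> a = a \<otimes> s"
      using a s by (simp add: t conj_by_mult_right)
    also have "a \<otimes> s \<otimes> s = a"
      using a s by (simp add: m_assoc)
    finally show ?thesis using a by simp
  qed
  ultimately show ?thesis
    using that[of "as @ [s] @ rev as"] as s by auto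
qed

text \<open>
  A reflection \<open>t\<close> occurs an odd number of times in its own word, so exactly one of \<open>w\<close> and \<open>tw\<close>
  has \<open>t\<close> among its odd reflections, and that one is the longer of the two.
\<close>

lemma left_inversions_word_prod:
  assumes "set ws \<subseteq> S"
  shows "left_inv (word_prod ws) = odd_reflections ws"
proof
  show "odd_reflections ws \<subseteq> left_inv (word_prod ws)"
    using odd_reflection_shortens[OF assms] by (auto simp: left_inversions_def)
  show "left_inv (word_prod ws) \<subseteq> odd_reflections ws"
  proof (rule subsetI, rule ccontr)
    fix t assume "t \<in> left_inv (word_prod ws)" and no: "t \<notin> odd_reflections ws"
    then have t: "t \<in> reflections W S" "len (t \<otimes> word_prod ws) < len (word_prod ws)"
      by (auto simp: left_inversions_def)
    obtain ts where ts: "set ts \<subseteq> S" "word_prod ts = t" "t \<in> odd_reflections ts" "t \<otimes> t = \<one>"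
      using reflection_word[OF t(1)] by blast
    have tc: "t \<in> carrier W"
      using ts word_prod_closed by blast
    have "conj_by (inv t) t = t"
      using tc by (simp add: conj_by_def)
    then have "t \<in> odd_reflections (ts @ ws)"
      using odd_reflections_append[OF ts(1) assms tc] ts no by simp
    then have "len (t \<otimes> word_prod (ts @ ws)) < len (word_prod (ts @ ws))"
      using odd_reflection_shortens[of "ts @ ws" t] ts assms by simp
    moreover have "word_prod (ts @ ws) = t \<otimes> word_prod ws"
      using word_prod_append[OF ts(1) assms] ts by simp
    moreover have "t \<otimes> (t \<otimes> word_prod ws) = word_prod ws"
      using tc ts assms by (simp add: m_assoc[symmetric])
    ultimately show False using t by simp
  qed
qed

lemma left_inversions_closed: "w \<in> carrier W \<Longrightarrow> left_inv w \<subseteq> carrier W"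
  by (metis left_inversions_word_prod odd_reflections_closed word_exists)

text \<open>
  In a concatenation of words for \<open>x\<close> and \<open>y\<close>, the reflections of the second word appear
  conjugated by \<open>x\<close>, and the parities of the two parts add up. This is the cocycle rule
  \<open>T\<^sub>L(xy) = T\<^sub>L(x) \<triangle> x T\<^sub>L(y) x\<^sup>-\<^sup>1\<close>.
\<close>

lemma left_inversions_mult:
  assumes "x \<in> carrier W" "y \<in> carrier W" "t \<in> carrier W"
  shows "t \<in> left_inv (x \<otimes> y) \<longleftrightarrow> (t \<in> left_inv x) \<noteq> (conj_by (inv x) t \<in> left_inv y)"
proof -
  obtain xs ys where "set xs \<subseteq> S" "word_prod xs = x" "set ys \<subseteq> S" "word_prod ys = y"
    using assms word_exists by metis
  then show ?thesis
    using odd_reflections_append[of xs ys t] left_inversions_word_prod[of "xs @ ys"]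
      left_inversions_word_prod[of xs] left_inversions_word_prod[of ys]
      word_prod_append[of xs ys] assms by auto
qed

lemma left_inversions_generator: "s \<in> S \<Longrightarrow> left_inv s = {s}"
  using left_inversions_word_prod[of "[s]"] by (auto simp: odd_reflections_def split: if_splits)

text \<open>
  A shortest word over \<open>J\<close> has distinct reflections, since the deletion property stays within
  the alphabet of the word.
\<close>

lemma distinct_word_exists:
  assumes "J \<subseteq> S" "w \<in> generate W J"
  obtains ws where "set ws \<subseteq> J" "word_prod ws = w" "distinct (word_reflections ws)"
proof -
  let ?P = "\<lambda>ws. set ws \<subseteq> J \<and> word_prod ws = w"
  obtain vs where "?P vs"
    using assms generate_eq_words by auto
  from ex_has_least_nat[of ?P, OF this, of length]
  obtain ws where ws: "set ws \<subseteq> J" "word_prod ws = w"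
    and least: "\<And>us. set us \<subseteq> J \<Longrightarrow> word_prod us = w \<Longrightarrow> length ws \<le> length us"
    by auto
  have "distinct (word_reflections ws)"
  proof (rule ccontr)
    assume "\<not> distinct (word_reflections ws)"
    then obtain us where "length us < length ws" "set us \<subseteq> set ws" "word_prod us = word_prod ws"
      using deletion[of ws] ws assms by blast
    with ws least[of us] show False by auto
  qed
  with ws that show ?thesis by blast
qed

lemma length_word_reflections [simp]: "length (word_reflections ws) = length ws"
  by (induction ws) auto

lemma left_inversions_distinct_word:
  assumes "set ws \<subseteq> S" "distinct (word_reflections ws)"
  shows "left_inv (word_prod ws) = set (word_reflections ws)"
    and "card (left_inv (word_prod ws)) = length ws"
proof -
  show *: "left_inv (word_prod ws) = set (word_reflections ws)"
    using left_inversions_word_prod odd_reflections_distinct assms by simp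
  show "card (left_inv (word_prod ws)) = length ws"
    unfolding * using distinct_card[OF assms(2)] by simp
qed

text \<open>
  The reflections of a reduced word are distinct, so each of them occurs an odd number of
  times.
\<close>

lemma len_eq_card_left_inversions:
  assumes "w \<in> carrier W"
  shows "len w = card (left_inv w)"
proof -
  obtain ws where ws: "set ws \<subseteq> S" "word_prod ws = w" "length ws = len w"
    using assms reduced_word_exists by blast
  have "distinct (word_reflections ws)"
  proof (rule ccontr)
    assume "\<not> distinct (word_reflections ws)"
    then obtain us where "length us < length ws" "set us \<subseteq> set ws" "word_prod us = word_prod ws"
      using deletion[of ws] ws by blast
    with ws len_le_word[of us] show False by auto
  qed
  then show ?thesis
    using left_inversions_distinct_word ws by metis
qed

lemma finite_left_inversions:
  assumes "w \<in> carrier W"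
  shows "finite (left_inv w)"
proof -
  obtain ws where "set ws \<subseteq> S" "word_prod ws = w"
    using assms word_exists by blast
  then show ?thesis
    using left_inversions_word_prod odd_reflections_subset finite_subset by (metis finite_set)
qed

lemma len_zero:
  assumes "w \<in> carrier W" "len w = 0"
  shows "w = \<one>"
  using reduced_word_exists[OF assms(1)] assms(2) by (metis foldr_Nil id_apply length_0_conv)

section \<open>Parabolic subgroups\<close>

lemma word_reflections_generate:
  assumes "J \<subseteq> S" "set ws \<subseteq> J"
  shows "set (word_reflections ws) \<subseteq> generate W J"
  using assms(2)
proof (induction ws)
  case (Cons s ws)
  have "conj_by s t \<in> generate W J" if "t \<in> generate W J" for t
    using that Cons.prems unfolding conj_by_def
    by (intro generate.eng[OF generate.eng]) (auto intro: generate.incl generate.inv)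
  with Cons show ?case by (auto intro: generate.incl)
qed simp

lemma left_inversions_generate:
  assumes "J \<subseteq> S" "w \<in> generate W J"
  shows "left_inv w \<subseteq> generate W J"
proof -
  obtain ws where ws: "set ws \<subseteq> J" "word_prod ws = w"
    using assms generate_eq_words by auto
  then have "left_inv w \<subseteq> set (word_reflections ws)"
    using left_inversions_word_prod[of ws] odd_reflections_subset[of ws] assms by auto
  with word_reflections_generate[OF assms(1) ws(1)] show ?thesis by blast
qed

text \<open>
  A word over \<open>J\<close> with distinct reflections has as many letters as its product has left
  inversions, and \<open>s\<close> has exactly one.
\<close>

lemma generator_in_generate:
  assumes "J \<subseteq> S" "s \<in> S" "s \<in> generate W J"
  shows "s \<in> J"
proof -
  obtain ws where ws: "set ws \<subseteq> J" "word_prod ws = s" "distinct (word_reflections ws)"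
    using distinct_word_exists assms by blast
  then have "length ws = 1"
    using left_inversions_distinct_word(2)[of ws] left_inversions_generator[OF assms(2)] assms
    by auto
  then obtain j where "ws = [j]"
    by (auto simp: length_Suc_conv)
  with ws assms show ?thesis by auto
qed

text \<open>
  The first letter of a reduced word is an inversion of its product and so lies in \<open>W\<^sub>J\<close>;
  a generator lying in \<open>W\<^sub>J\<close> belongs to \<open>J\<close>.
\<close>

lemma distinct_word_support:
  assumes "J \<subseteq> S" "set ws \<subseteq> S" "distinct (word_reflections ws)" "word_prod ws \<in> generate W J"
  shows "set ws \<subseteq> J"
  using assms(2-)
proof (induction ws)
  case (Cons s ws)
  have "s \<in> left_inv (word_prod (s # ws))"
    using left_inversions_distinct_word(1)[of "s # ws"] Cons.prems by simp
  then have sJ: "s \<in> generate W J"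
    using left_inversions_generate[OF assms(1)] Cons.prems by blast
  have "s \<otimes> (s \<otimes> word_prod ws) = word_prod ws"
    using Cons.prems by (simp add: m_assoc[symmetric])
  then have "word_prod ws \<in> generate W J"
    using generate.eng[OF sJ, of "word_prod (s # ws)"] Cons.prems by simp
  moreover have "distinct (word_reflections ws)"
    using Cons.prems by (auto simp: distinct_map)
  ultimately show ?case
    using Cons generator_in_generate[OF assms(1) _ sJ] by auto
qed simp

text \<open>
  Whatever \<open>J\<close> with \<open>w \<in> W\<^sub>J\<close> is chosen, the letters of one fixed reduced word of \<open>w\<close> lie in
  \<open>J\<close>. Intersecting with \<open>S\<close> covers the empty family, for which the parabolic subgroup is the
  whole group.
\<close>

lemma generate_Inter:
  assumes "E \<subseteq> Pow S" "w \<in> carrier W" "\<And>J. J \<in> E \<Longrightarrow> w \<in> generate W J"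
  shows "w \<in> generate W (S \<inter> \<Inter>E)"
proof -
  obtain ws where ws: "set ws \<subseteq> S" "word_prod ws = w" "distinct (word_reflections ws)"
    using distinct_word_exists[of S w] assms(2) generate_S by auto
  have "set ws \<subseteq> J" if "J \<in> E" for J
    using distinct_word_support[of J ws] assms that ws by auto
  with ws have "set ws \<subseteq> S \<inter> \<Inter>E" by auto
  with ws show ?thesis
    using word_prod_in_generate[of "S \<inter> \<Inter>E" ws] by auto
qed

text \<open>
  For an element \<open>x\<close> that is shortest in \<open>x W\<^sub>J\<close>, the two parts of the cocycle rule cannot
  overlap: a common inversion would carry \<open>x\<close> to a shorter element of the same coset.
\<close>

lemma shortest_disjoint:
  assumes "J \<subseteq> S" "x \<in> carrier W" "y \<in> generate W J"
    and shortest: "\<And>z. z \<in> generate W J \<Longrightarrow> len x \<le> len (x \<otimes> z)"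
    and "t \<in> left_inv x"
  shows "conj_by (inv x) t \<notin> left_inv y"
proof
  assume r: "conj_by (inv x) t \<in> left_inv y"
  have t: "t \<in> carrier W" "len (t \<otimes> x) < len x"
    using assms left_inversions_closed by (auto simp: left_inversions_def)
  have "conj_by (inv x) t \<in> generate W J"
    using r left_inversions_generate assms by blast
  from shortest[OF this] have "len x \<le> len (t \<otimes> x)"
    using t assms by (simp add: conj_by_def m_assoc[symmetric])
  with t show False by simp
qed

lemma shortest_left_inversions:
  assumes "J \<subseteq> S" "x \<in> carrier W" "y \<in> generate W J"
    and "\<And>z. z \<in> generate W J \<Longrightarrow> len x \<le> len (x \<otimes> z)"
  shows "left_inv (x \<otimes> y) = left_inv x \<union> conj_by x ` left_inv y"
    and "len (x \<otimes> y) = len x + len y"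
proof -
  have y: "y \<in> carrier W"
    using assms generate_closed by blast
  have image: "t \<in> conj_by x ` left_inv y \<longleftrightarrow> conj_by (inv x) t \<in> left_inv y"
    if "t \<in> carrier W" for t
  proof
    assume "t \<in> conj_by x ` left_inv y"
    then obtain r where "r \<in> left_inv y" "t = conj_by x r"
      by blast
    then show "conj_by (inv x) t \<in> left_inv y"
      using left_inversions_closed[OF y] assms(2) by auto
  next
    assume "conj_by (inv x) t \<in> left_inv y"
    then show "t \<in> conj_by x ` left_inv y"
      using that assms(2) by (intro image_eqI[of _ _ "conj_by (inv x) t"]) auto
  qed
  have disj: "conj_by (inv x) t \<notin> left_inv y" if "t \<in> left_inv x" for t
    using shortest_disjoint[OF assms(1-3) _ that] assms(4) by blast
  have closed: "left_inv (x \<otimes> y) \<subseteq> carrier W" "left_inv x \<subseteq> carrier W"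
    "conj_by x ` left_inv y \<subseteq> carrier W"
    using left_inversions_closed[of "x \<otimes> y"] left_inversions_closed[of x]
      left_inversions_closed[of y] assms(2) y by auto
  show union: "left_inv (x \<otimes> y) = left_inv x \<union> conj_by x ` left_inv y"
  proof -
    have "t \<in> left_inv (x \<otimes> y) \<longleftrightarrow> t \<in> left_inv x \<union> conj_by x ` left_inv y" for t
    proof (cases "t \<in> carrier W")
      case True
      then show ?thesis
        using left_inversions_mult[OF assms(2) y True] image[OF True] disj[of t] by auto
    next
      case False
      then show ?thesis using closed by blast
    qed
    then show ?thesis by blast
  qed
  have inter: "left_inv x \<inter> conj_by x ` left_inv y = {}"
    using image disj closed(2) by (meson disjoint_iff subsetD)
  have "inj_on (conj_by x) (left_inv y)"
    using inj_on_conj_by[OF assms(2)] left_inversions_closed[OF y] inj_on_subset by blast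
  then have "card (left_inv (x \<otimes> y)) = card (left_inv x) + card (left_inv y)"
    unfolding union using inter finite_left_inversions assms y
    by (subst card_Un_disjoint) (auto simp: card_image)
  then show "len (x \<otimes> y) = len x + len y"
    using len_eq_card_left_inversions assms y by simp
qed

lemma shortest_exists:
  assumes "J \<subseteq> S" "w \<in> carrier W"
  obtains x y where "x \<in> carrier W" "y \<in> generate W J" "w = x \<otimes> y"
    "\<And>z. z \<in> generate W J \<Longrightarrow> len x \<le> len (x \<otimes> z)"
proof -
  let ?H = "generate W J"
  have H: "subgroup ?H W"
    using assms subgroup_generate by blast
  from ex_has_least_nat[of "\<lambda>h. h \<in> ?H", OF subgroup.one_closed[OF H], of "\<lambda>h. len (w \<otimes> h)"]
  obtain h where h: "h \<in> ?H" "\<And>z. z \<in> ?H \<Longrightarrow> len (w \<otimes> h) \<le> len (w \<otimes> z)"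
    by auto
  have hc: "h \<in> carrier W"
    using h assms generate_closed by blast
  have "len (w \<otimes> h) \<le> len (w \<otimes> h \<otimes> z)" if "z \<in> ?H" for z
    using h(2)[of "h \<otimes> z"] subgroup.m_closed[OF H h(1) that] generate_closed[OF assms(1) that]
      hc assms(2) by (simp add: m_assoc)
  moreover have "w = (w \<otimes> h) \<otimes> inv h"
    using hc assms by (simp add: m_assoc)
  ultimately show ?thesis
    using that[of "w \<otimes> h" "inv h"] hc assms(2) subgroup.m_inv_closed[OF H h(1)] by simp
qed

text \<open>
  By additivity of lengths, \<open>x z\<close> is as short as \<open>x\<close> only if \<open>\<ell>(z) = 0\<close>; hence the shortest
  element of the coset is unique and the definite description denotes it.
\<close>

lemma min_coset_rep_eq:
  assumes "J \<subseteq> S" "x \<in> carrier W" "y \<in> generate W J"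
    and "\<And>z. z \<in> generate W J \<Longrightarrow> len x \<le> len (x \<otimes> z)"
  shows "min_coset_rep W S J (x \<otimes> y) = x"
proof -
  let ?H = "generate W J"
  have H: "subgroup ?H W"
    using assms subgroup_generate by blast
  have y: "y \<in> carrier W"
    using assms generate_closed by blast
  have "x \<otimes> y <# ?H = x <# (y <# ?H)"
    using assms y subgroup.subset[OF H] by (simp add: lcos_m_assoc)
  also have "y <# ?H = ?H"
    using assms(3) H coset_join3 y by blast
  finally have coset: "x \<otimes> y <# ?H = (\<lambda>z. x \<otimes> z) ` ?H"
    by (auto simp: l_coset_def)
  show ?thesis
    unfolding min_coset_rep_def coset
  proof (rule the_equality)
    show "x \<in> (\<lambda>z. x \<otimes> z) ` ?H \<and> (\<forall>z \<in> (\<lambda>z. x \<otimes> z) ` ?H. len x \<le> len z)"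
      using assms subgroup.one_closed[OF H] by (auto intro!: image_eqI[of _ _ \<one>])
  next
    fix q assume q: "q \<in> (\<lambda>z. x \<otimes> z) ` ?H \<and> (\<forall>z \<in> (\<lambda>z. x \<otimes> z) ` ?H. len q \<le> len z)"
    then obtain z where z: "z \<in> ?H" "q = x \<otimes> z"
      by auto
    have "len q \<le> len (x \<otimes> \<one>)"
      using q subgroup.one_closed[OF H] by blast
    moreover have "len q = len x + len z"
      using shortest_left_inversions(2)[OF assms(1,2) z(1)] assms(4) z by blast
    ultimately have "len z = 0"
      using assms by simp
    then show "q = x"
      using len_zero z assms generate_closed by simp
  qed
qed

text \<open>
  If \<open>w = x y\<close> with \<open>x\<close> shortest in \<open>w W\<^sub>J\<close> and \<open>y \<noteq> \<one>\<close>, then lengths add up, so the last letter of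
  a reduced word of \<open>y\<close> over \<open>J\<close> is a right descent of \<open>w\<close>.
\<close>

lemma shortest_if_no_descent:
  assumes "J \<subseteq> S" "w \<in> carrier W" "J \<inter> right_descents W S w = {}" "z \<in> generate W J"
  shows "len w \<le> len (w \<otimes> z)"
proof -
  obtain x y where xy: "x \<in> carrier W" "y \<in> generate W J" "w = x \<otimes> y"
    and shortest: "\<And>z. z \<in> generate W J \<Longrightarrow> len x \<le> len (x \<otimes> z)"
    using shortest_exists[OF assms(1,2)] by metis
  obtain ws where ws: "set ws \<subseteq> J" "word_prod ws = y" "distinct (word_reflections ws)"
    using distinct_word_exists[OF assms(1) xy(2)] by blast
  have "ws = []"
  proof (rule ccontr)
    assume "ws \<noteq> []"
    then obtain us s where us: "ws = us @ [s]"
      by (meson rev_exhaust)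
    then have sets: "set us \<subseteq> J" "s \<in> J" "set us \<subseteq> S" "s \<in> S"
      using ws assms by auto
    have y: "y = word_prod us \<otimes> s"
      using ws us sets word_prod_append[of us "[s]"] by simp
    have "w \<otimes> s = x \<otimes> word_prod us \<otimes> (s \<otimes> s)"
      using sets xy y by (simp add: m_assoc del: generator_square)
    then have "w \<otimes> s = x \<otimes> word_prod us"
      using sets xy by simp
    moreover have "len (x \<otimes> word_prod us) = len x + len (word_prod us)"
      using shortest_left_inversions(2)[OF assms(1) xy(1) _ shortest]
        word_prod_in_generate[OF assms(1) sets(1)] by blast
    moreover have "len w = len x + len y"
      using shortest_left_inversions(2)[OF assms(1) xy(1,2) shortest] xy by simp
    moreover have "len y = length ws"
      using left_inversions_distinct_word(2)[of ws] len_eq_card_left_inversions[of y] ws assms(1)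
        generate_closed[OF assms(1) xy(2)] by simp
    moreover have "len (word_prod us) \<le> length us"
      using len_le_word sets by blast
    ultimately have "len (w \<otimes> s) < len w"
      using us by simp
    with sets assms(3) show False
      by (auto simp: right_descents_def)
  qed
  with ws(2) have "y = \<one>" by simp
  with xy have "w = x" by simp
  with shortest assms show ?thesis by blast
qed

section \<open>Left inversions along the right weak order\<close>

text \<open>
  For \<open>v = us\<close> the two inversion sets differ only by the reflection \<open>u s u\<^sup>-\<^sup>1\<close>. It is not an
  inversion of \<open>u\<close>, because it takes \<open>u\<close> to the longer element \<open>v\<close>.
\<close>

lemma left_inversions_cover:
  assumes "right_weak_cover W S u v"
  shows "left_inv u \<subseteq> left_inv v"
proof
  fix t assume t: "t \<in> left_inv u"
  define s where "s = inv u \<otimes> v"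
  have c: "u \<in> carrier W" "v \<in> carrier W" "s \<in> S" "len u < len v"
    using assms by (auto simp: right_weak_cover_def s_def)
  have v: "v = u \<otimes> s"
    using c by (simp add: s_def m_assoc[symmetric])
  have tc: "t \<in> carrier W"
    using t c left_inversions_closed by blast
  have "conj_by (inv u) t \<noteq> s"
  proof
    assume "conj_by (inv u) t = s"
    then have "t = conj_by u s"
      using c tc by auto
    then have "t \<otimes> u = v"
      using c v conj_by_mult_right by simp
    with t c show False
      by (simp add: left_inversions_def)
  qed
  then show "t \<in> left_inv v"
    using left_inversions_mult[of u s t] left_inversions_generator c tc t v by auto
qed

lemma left_inversions_weak_mono:
  assumes "right_weak_le W S u v"
  shows "left_inv u \<subseteq> left_inv v"
proof -
  have "(right_weak_cover W S)\<^sup>*\<^sup>* u v"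
    using assms by (simp add: right_weak_le_def)
  then show ?thesis
    by induction (use left_inversions_cover in blast)+
qed

text \<open>
  With \<open>v = x y\<close> and \<open>x = v\<^sup>J\<close>, an inversion of \<open>v\<close> that is lost in \<open>v\<^sup>J\<close> has the form \<open>x r x\<^sup>-\<^sup>1\<close>
  with \<open>r \<in> T\<^sub>L(y) \<subseteq> W\<^sub>J\<close>, and conjugating it by \<open>v\<^sup>-\<^sup>1\<close> instead of \<open>x\<^sup>-\<^sup>1\<close> stays in \<open>W\<^sub>J\<close>.
\<close>

lemma left_inversions_min_coset_rep:
  assumes "J \<subseteq> S" "v \<in> carrier W"
  shows "left_inv (min_coset_rep W S J v) \<subseteq> left_inv v"
    and "t \<in> left_inv v \<Longrightarrow> t \<notin> left_inv (min_coset_rep W S J v) \<Longrightarrow>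
      conj_by (inv v) t \<in> generate W J"
proof -
  obtain x y where xy: "x \<in> carrier W" "y \<in> generate W J" "v = x \<otimes> y"
    and shortest: "\<And>z. z \<in> generate W J \<Longrightarrow> len x \<le> len (x \<otimes> z)"
    using shortest_exists[OF assms] by metis
  have rep: "min_coset_rep W S J v = x"
    using min_coset_rep_eq[OF assms(1) xy(1,2) shortest] xy by simp
  note union = shortest_left_inversions(1)[OF assms(1) xy(1,2) shortest]
  show "left_inv (min_coset_rep W S J v) \<subseteq> left_inv v"
    using union by (simp add: rep xy(3)[symmetric])
  show "conj_by (inv v) t \<in> generate W J"
    if t: "t \<in> left_inv v" "t \<notin> left_inv (min_coset_rep W S J v)"
  proof -
    obtain r where r: "r \<in> left_inv y" "t = conj_by x r"
      using t(1)[unfolded xy(3)] t(2)[unfolded rep] union by auto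
    have rJ: "r \<in> generate W J"
      using r left_inversions_generate[OF assms(1) xy(2)] by blast
    have yc: "y \<in> carrier W" and rc: "r \<in> carrier W"
      using rJ xy assms generate_closed by auto
    have "conj_by (inv v) t = conj_by (inv y) r"
      using xy(1) yc rc unfolding xy(3) r(2) by (simp add: conj_by_mult m_assoc inv_mult_group)
    also have "\<dots> \<in> generate W J"
      using subgroup_generate[OF assms(1)] rJ xy(2) yc
      by (auto simp: conj_by_def subgroup.m_closed subgroup.m_inv_closed)
    finally show ?thesis .
  qed
qed

text \<open>
  An inversion \<open>t\<close> of \<open>v\<close> missing from the right-hand side is transported to the right of
  \<open>w = u\<^sup>-\<^sup>1 v\<close> as \<open>r = v\<^sup>-\<^sup>1 t v\<close>. It would shorten \<open>w\<close> from within \<open>W\<^sub>K\<close>, where \<open>K\<close> contains no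
  right descent of \<open>w\<close>.
\<close>

theorem left_inversions_decomposition:
  assumes "u \<in> carrier W" "v \<in> carrier W" "right_weak_le W S u v" "E \<subseteq> Pow S"
    and K: "S \<inter> \<Inter>E = S - right_descents W S (inv u \<otimes> v)"
  shows "left_inv v = left_inv u \<union> (\<Union>J\<in>E. left_inv (min_coset_rep W S J v))"
proof
  show "left_inv u \<union> (\<Union>J\<in>E. left_inv (min_coset_rep W S J v)) \<subseteq> left_inv v"
  proof (intro Un_least UN_least)
    show "left_inv u \<subseteq> left_inv v"
      using left_inversions_weak_mono[OF assms(3)] .
    show "left_inv (min_coset_rep W S J v) \<subseteq> left_inv v" if "J \<in> E" for J
      by (rule left_inversions_min_coset_rep(1)[OF _ assms(2)]) (use that assms(4) in auto)
  qed
  show "left_inv v \<subseteq> left_inv u \<union> (\<Union>J\<in>E. left_inv (min_coset_rep W S J v))"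
  proof (rule subsetI, rule ccontr)
    fix t assume t: "t \<in> left_inv v"
      and no: "t \<notin> left_inv u \<union> (\<Union>J\<in>E. left_inv (min_coset_rep W S J v))"
    define w where "w = inv u \<otimes> v"
    define r where "r = conj_by (inv v) t"
    have w: "w \<in> carrier W" "v = u \<otimes> w"
      using assms(1,2) by (simp_all add: w_def m_assoc[symmetric])
    have tc: "t \<in> carrier W"
      using t left_inversions_closed assms by blast
    have "r \<in> generate W J" if "J \<in> E" for J
      unfolding r_def using that assms(4) no
      by (intro left_inversions_min_coset_rep(2)[OF _ assms(2) t]) auto
    then have "r \<in> generate W (S \<inter> \<Inter>E)"
      using generate_Inter[OF assms(4), of r] assms(2) tc by (simp add: r_def)
    then have "len w \<le> len (w \<otimes> r)"
      using shortest_if_no_descent[of "S \<inter> \<Inter>E" w r] w(1) K by (auto simp: w_def)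
    moreover have "conj_by (inv u) t \<in> left_inv w"
      using left_inversions_mult[OF assms(1) w(1) tc] t no w(2) by auto
    then have "len (conj_by (inv u) t \<otimes> w) < len w"
      by (simp add: left_inversions_def)
    moreover have "conj_by (inv u) t \<otimes> w = w \<otimes> r"
    proof -
      have "conj_by w r = conj_by (w \<otimes> inv v) t"
        using w(1) assms(2) tc by (simp add: r_def conj_by_mult)
      also have "w \<otimes> inv v = inv u"
        using assms(1,2) by (simp add: w_def m_assoc)
      finally show ?thesis
        using conj_by_mult_right[of w r] w(1) assms(2) tc by (simp add: r_def)
    qed
    ultimately show False by simp
  qed
qed

end

theorem theorem2p1:
  fixes W :: "('a, 'b) monoid_scheme" and S :: "'a set" and m :: "'a \<Rightarrow> 'a \<Rightarrow> enat"
    and u v :: 'a and E :: "'a set set"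
  assumes "coxeter_system W S m"
    and "u \<in> carrier W" and "v \<in> carrier W"
    and "right_weak_le W S u v"
    and "E \<subseteq> Pow S"
    and "S \<inter> \<Inter>E = S - right_descents W S (inv\<^bsub>W\<^esub> u \<otimes>\<^bsub>W\<^esub> v)"
  shows "left_inversions W S v =
    left_inversions W S u \<union> (\<Union>J\<in>E. left_inversions W S (min_coset_rep W S J v))"
proof -
  have "group W"
    using assms(1) by (simp add: coxeter_system_def has_presentation_def)
  then interpret coxeter_group W S m
    using assms(1) by (simp add: coxeter_group_def coxeter_group_axioms_def)
  show ?thesis
    using left_inversions_decomposition assms(2-) by blast
qed

end
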